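(* Let $h^b$, $b\ge0$, be the metrics on $M=\mathbb{R}_{>0}\times\mathbb{R}^3$ defined in the context, and identify $M$ with the open unit ball in $\mathbb{R}^4$, with boundary $\partial M=S^3$, via the coordinates $(w,x,y,z)$ of the context. For $b>0$ the conformal structure $[h^b|_{\partial M}]$ on the boundary sphere is singular at $w=-1$, and away from the singularity it is given by $$[h^b|_{\partial M}]=\left[\left.\left(\tfrac12\left(d\left(\tfrac{2x}{1+w}\right)+\tfrac b2\,\tfrac{y}{1+w}\,d\left(\tfrac{z}{1+w}\right)-\tfrac b2\,\tfrac{z}{1+w}\,d\left(\tfrac{y}{1+w}\right)\right)^2+2\left(\left(d\left(\tfrac{y}{1+w}\right)\right)^2+\left(d\left(\tfrac{z}{1+w}\right)\right)^2\right)\right)\right|_{\partial M}\right].$$ Moreover, for $b=0$, the conformal structure $[h^0|_{\partial M}]$ is the standard conformal structure on $S^3$.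
   Context: With coordinates $(\rho',\tilde\phi',\zeta'^0,\tilde\zeta'_0)$ on $M$, $\rho'>0$, $$h^b=\frac{1}{4\rho'^2}\left[\frac{b\rho'+2}{b\rho'+1}\,d\rho'^2+\frac{b\rho'+1}{b\rho'+2}\,(d\tilde\phi'+b\zeta'^0 d\tilde\zeta'_0-b\tilde\zeta'_0 d\zeta'^0)^2+2(b\rho'+2)\left((d\tilde\zeta'_0)^2+(d\zeta'^0)^2\right)\right].$$ The diffeomorphism between $M$ and the open unit ball $\{w^2+x^2+y^2+z^2<1\}\subset\mathbb{R}^4$ is given, with $N=(1+w)^2+x^2+y^2+z^2$, by $$\rho'=\frac{1-w^2-x^2-y^2-z^2}{N},\quad \tilde\phi'=\frac{4x}{N},\quad \zeta'^0=\frac{\sqrt2\,y}{N},\quad \tilde\zeta'_0=\frac{\sqrt2\,z}{N}.$$ The boundary $\partial M$ (the hyperplane $\rho'=0$ together with a point at infinity $p_\infty$) corresponds to the unit sphere $S^3\subset\mathbb{R}^4$, with $p_\infty$ corresponding to the south pole $(-1,0,0,0)$, the only point of $S^3$ with $w=-1$. $[h^b|_{\partial M}]$ is the conformal class (metrics up to multiplication by positive functions) of the restriction to $\partial M$ of $4\rho'^2h^b$, computed at points with $w\neq-1$. "Singular" at $w=-1$ (for $b>0$) refers to the double pole that the structure has at the south pole. The standard conformal structure on $S^3$ is the conformal class of the restriction to $S^3$ of the Euclidean metric of $\mathbb{R}^4$. *)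

theory Defs
  imports "HOL-Analysis.Analysis"
begin

text \<open>A covariant 2-tensor field is a function \<open>g p u v\<close> of a point and two tangent vectors.
  The square of a one-form \<open>\<alpha>\<close> is the symmetric bilinear form \<open>(u, v) \<mapsto> \<alpha> u * \<alpha> v\<close>.\<close>

type_synonym 'a tensor2 = "'a \<Rightarrow> 'a \<Rightarrow> 'a \<Rightarrow> real"

text \<open>Points of \<open>M\<close> and tangent vectors to \<open>M\<close> are written in the order
  \<open>(\<rho>', \<phi>', \<zeta>'\<^sup>0, \<zeta>'\<^sub>0)\<close>, where \<open>\<phi>'\<close> and \<open>\<zeta>'\<^sub>0\<close> are the coordinates carrying a tilde.
  The metric is used only where \<open>\<rho>' > 0\<close>.\<close>

type_synonym coords = "real \<times> real \<times> real \<times> real"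

fun h_metric :: "real \<Rightarrow> coords tensor2" where
  "h_metric b (\<rho>, \<phi>, \<zeta>, \<eta>) (d\<rho>, d\<phi>, d\<zeta>, d\<eta>) (d\<rho>', d\<phi>', d\<zeta>', d\<eta>') =
     1 / (4 * \<rho>\<^sup>2) *
       ((b * \<rho> + 2) / (b * \<rho> + 1) * (d\<rho> * d\<rho>')
        + (b * \<rho> + 1) / (b * \<rho> + 2)
            * ((d\<phi> + b * \<zeta> * d\<eta> - b * \<eta> * d\<zeta>) * (d\<phi>' + b * \<zeta> * d\<eta>' - b * \<eta> * d\<zeta>'))
        + 2 * (b * \<rho> + 2) * (d\<eta> * d\<eta>' + d\<zeta> * d\<zeta>'))"

text \<open>In \<open>real^4\<close> the components \<open>1, 2, 3, 4\<close> are \<open>w, x, y, z\<close>.\<close>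

definition ball_denom :: "real^4 \<Rightarrow> real" where
  "ball_denom p = (1 + p$1)\<^sup>2 + (p$2)\<^sup>2 + (p$3)\<^sup>2 + (p$4)\<^sup>2"

definition ball_rho :: "real^4 \<Rightarrow> real" where
  "ball_rho p = (1 - (p$1)\<^sup>2 - (p$2)\<^sup>2 - (p$3)\<^sup>2 - (p$4)\<^sup>2) / ball_denom p"

definition ball_coords :: "real^4 \<Rightarrow> coords" where
  "ball_coords p =
     (ball_rho p, 4 * p$2 / ball_denom p, sqrt 2 * p$3 / ball_denom p, sqrt 2 * p$4 / ball_denom p)"

definition pullback :: "(real^4 \<Rightarrow> coords) \<Rightarrow> coords tensor2 \<Rightarrow> (real^4) tensor2" where
  "pullback F g p u v = g (F p) (frechet_derivative F (at p) u) (frechet_derivative F (at p) v)"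

definition h_ball :: "real \<Rightarrow> (real^4) tensor2" where
  "h_ball b = pullback ball_coords (h_metric b)"

definition south_pole :: "real^4" where
  "south_pole = - axis 1 1"

definition S3 :: "(real^4) set" where
  "S3 = sphere 0 1"

definition punctured_S3 :: "(real^4) set" where
  "punctured_S3 = S3 - {south_pole}"

definition sphere_tangent :: "real^4 \<Rightarrow> (real^4) set" where
  "sphere_tangent p = {u. u \<bullet> p = 0}"

text \<open>The restriction of \<open>4 \<rho>'\<^sup>2 h\<^sup>b\<close> to the boundary: the extension by continuity from the open ball
  (\<open>h\<^sup>b\<close> itself is not defined at \<open>\<rho>' = 0\<close>), to be evaluated on tangent vectors of the sphere.\<close>

definition boundary_metric :: "real \<Rightarrow> (real^4) tensor2" where
  "boundary_metric b p u v =
     Lim (at p within ball 0 1) (\<lambda>q. 4 * (ball_rho q)\<^sup>2 * h_ball b q u v)"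

text \<open>The tensor fields on \<open>X \<subseteq> S\<^sup>3\<close> that are positive multiples of \<open>g\<close>; only their values at points
  of \<open>X\<close> and on vectors tangent to the sphere matter. If two such fields are smooth metrics, the
  factor relating them is automatically smooth, so no regularity is imposed on it.\<close>

definition conformal_class :: "(real^4) set \<Rightarrow> (real^4) tensor2 \<Rightarrow> (real^4) tensor2 set" where
  "conformal_class X g =
     {g'. \<exists>f. (\<forall>p\<in>X. 0 < f p) \<and>
          (\<forall>p\<in>X. \<forall>u\<in>sphere_tangent p. \<forall>v\<in>sphere_tangent p. g' p u v = f p * g p u v)}"

definition continuous_metric_on :: "(real^4) set \<Rightarrow> (real^4) tensor2 \<Rightarrow> bool" where
  "continuous_metric_on X g \<longleftrightarrow>
     (\<forall>p\<in>X. \<forall>u\<in>sphere_tangent p. \<forall>v\<in>sphere_tangent p. g p u v = g p v u) \<and>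
     (\<forall>p\<in>X. \<forall>u\<in>sphere_tangent p. \<forall>v\<in>sphere_tangent p. \<forall>w\<in>sphere_tangent p. \<forall>r s.
        g p (r *\<^sub>R u + s *\<^sub>R v) w = r * g p u w + s * g p v w) \<and>
     (\<forall>p\<in>X. \<forall>u\<in>sphere_tangent p. u \<noteq> 0 \<longrightarrow> 0 < g p u u) \<and>
     continuous_on {(p, u, v). p \<in> X \<and> u \<in> sphere_tangent p \<and> v \<in> sphere_tangent p}
       (\<lambda>(p, u, v). g p u v)"

text \<open>The metrics on the whole sphere, continuous also at the south pole, whose restriction to the
  punctured sphere belongs to a given conformal class there.\<close>

definition metric_extensions :: "(real^4) tensor2 set \<Rightarrow> (real^4) tensor2 set" where
  "metric_extensions C = {G \<in> C. continuous_metric_on S3 G}"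

text \<open>The pole order of a conformal class only makes sense after normalising the representative,
  since the factor may itself vanish or blow up. We use the representative with the same volume
  form as the round metric: its Gram determinant is 1 in every round-orthonormal frame.\<close>

definition round_volume_on :: "(real^4) set \<Rightarrow> (real^4) tensor2 \<Rightarrow> bool" where
  "round_volume_on X g \<longleftrightarrow>
     (\<forall>p\<in>X. \<forall>e :: 3 \<Rightarrow> real^4.
        (\<forall>i. e i \<in> sphere_tangent p) \<and> (\<forall>i j. e i \<bullet> e j = (if i = j then 1 else 0)) \<longrightarrow>
        det (\<chi> i j. g p (e i) (e j) :: real^3^3) = 1)"

definition growth_at_most :: "(real^4) set \<Rightarrow> real^4 \<Rightarrow> (real^4) tensor2 \<Rightarrow> nat \<Rightarrow> bool" where
  "growth_at_most X a g n \<longleftrightarrow>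
     (\<exists>K. \<forall>\<^sub>F p in at a within X. \<forall>u\<in>sphere_tangent p. \<forall>v\<in>sphere_tangent p.
        dist p a ^ n * \<bar>g p u v\<bar> \<le> K * norm u * norm v)"

definition has_pole_of_order ::
    "(real^4) set \<Rightarrow> real^4 \<Rightarrow> (real^4) tensor2 set \<Rightarrow> nat \<Rightarrow> bool" where
  "has_pole_of_order X a C n \<longleftrightarrow>
     (\<exists>g\<in>C. round_volume_on X g \<and> growth_at_most X a g n \<and> (\<forall>m<n. \<not> growth_at_most X a g m))"

abbreviation differential :: "(real^4 \<Rightarrow> real) \<Rightarrow> real^4 \<Rightarrow> real^4 \<Rightarrow> real" where
  "differential f p \<equiv> frechet_derivative f (at p)"

definition boundary_form :: "real \<Rightarrow> real^4 \<Rightarrow> real^4 \<Rightarrow> real" where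
  "boundary_form b p u =
     differential (\<lambda>q. 2 * q$2 / (1 + q$1)) p u
     + b / 2 * (p$3 / (1 + p$1)) * differential (\<lambda>q. q$4 / (1 + q$1)) p u
     - b / 2 * (p$4 / (1 + p$1)) * differential (\<lambda>q. q$3 / (1 + q$1)) p u"

definition boundary_model :: "real \<Rightarrow> (real^4) tensor2" where
  "boundary_model b p u v =
     1 / 2 * (boundary_form b p u * boundary_form b p v)
     + 2 * (differential (\<lambda>q. q$3 / (1 + q$1)) p u * differential (\<lambda>q. q$3 / (1 + q$1)) p v
          + differential (\<lambda>q. q$4 / (1 + q$1)) p u * differential (\<lambda>q. q$4 / (1 + q$1)) p v)"

definition round_metric :: "(real^4) tensor2" where
  "round_metric p u v = u \<bullet> v"

end

theory Submission
  imports Defs "HOL-Real_Asymp.Real_Asymp"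
begin

text \<open>The three stereographic coordinates $X = x/(1+w)$, $Y = y/(1+w)$, $Z = z/(1+w)$ have
  differentials $\theta_i/(1+w)$, where $\theta_2, \theta_3, \theta_4$ (named \<open>coframe\<close> below) is an
  orthonormal coframe of the punctured round sphere. Everything is expressed in this coframe.

  On tangent vectors of the sphere the differential of $\rho'$ vanishes at the boundary, $N$ equals
  $2(1+w)$ and its differential equals that of $2w$. So the limit of $4\rho'^2 h^b$ involves only
  the differentials of $2X$, $Y/\sqrt 2$ and $Z/\sqrt 2$, and equals $2/(1+w)^2$ times
  \[ g_b = \Bigl(\theta_2 + \frac b4 (Y\theta_4 - Z\theta_3)\Bigr)^2 + \theta_3^2 + \theta_4^2, \]
  called \<open>unimodular_metric\<close> below (\<open>boundary_metric_eq\<close>). The explicit boundary expression is the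
  same multiple of $g_b$ (\<open>boundary_model_eq\<close>), so the two conformal classes agree and $g_b$
  represents both.

  The three one-forms squared in $g_b$ arise from an orthonormal coframe by a shear, so $g_b$ has the round
  volume form (\<open>det_unimodular\<close>) and is the representative in which the order of the pole
  is read off. Since $|p-s|^2 = 2(1+w)$ for the south pole $s$, the coefficients $Y$ and $Z$ are
  at most $2/|p-s|$, whence $g_b$ grows at most like $|p-s|^{-2}$ (\<open>growth_at_most_2\<close>). Along the meridian
  $x = z = 0$ the coordinate vectors of $x$ and $z$ are tangent to the sphere, also at $s$, and have
  squared length $1$ and $1 + (bY/4)^2$. For $b > 0$ the second tends to infinity like
  $|p-s|^{-2}$, so the order is exactly 2; and as the ratio of the two is conformally
  invariant and unbounded, no conformal multiple extends to a continuous metric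
  (\<open>no_metric_extension\<close>).

  For $b = 0$ the metric $g_0$ is the sum of the squares of an orthonormal coframe, that is, the round
  metric. A continuous metric on the whole sphere that is conformally round off $s$ is conformally
  round at $s$ too, by passing to the limit along the meridian (\<open>metric_extensions_round\<close>).\<close>

section \<open>An orthonormal coframe from stereographic coordinates\<close>

text \<open>For \<open>i = 2, 3, 4\<close> this is $(1+w)$ times the differential of the stereographic coordinate
  \<open>p$i / (1 + w)\<close>.\<close>

definition coframe :: "4 \<Rightarrow> real^4 \<Rightarrow> real^4 \<Rightarrow> real" where
  "coframe i p u = u$i - p$i * u$1 / (1 + p$1)"

text \<open>This is $(1+w)$ times half of \<open>boundary_form\<close>. For $b > 0$ it is a contact form of Heisenberg
  type in the stereographic coordinates.\<close>

definition contact_form :: "real \<Rightarrow> real^4 \<Rightarrow> real^4 \<Rightarrow> real" where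
  "contact_form b p u =
     coframe 2 p u + b / 4 * (p$3 / (1 + p$1) * coframe 4 p u - p$4 / (1 + p$1) * coframe 3 p u)"

definition unimodular_metric :: "real \<Rightarrow> (real^4) tensor2" where
  "unimodular_metric b p u v =
     contact_form b p u * contact_form b p v + coframe 3 p u * coframe 3 p v + coframe 4 p u * coframe 4 p v"

lemma inner_4: "u \<bullet> v = u$1 * v$1 + u$2 * v$2 + u$3 * v$3 + u$4 * v$4" for u v :: "real^4"
  by (simp add: inner_vec_def sum_4)

lemma south_pole_nth: "south_pole $ 1 = -1" "i \<noteq> 1 \<Longrightarrow> south_pole $ i = 0"
  by (simp_all add: south_pole_def axis_def)

lemma mem_S3_iff: "p \<in> S3 \<longleftrightarrow> p \<bullet> p = 1"
  by (simp add: S3_def dist_norm norm_eq_1)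

lemma sphere_tangentD: "u \<in> sphere_tangent p \<Longrightarrow> u \<bullet> p = 0"
  by (simp add: sphere_tangent_def)

text \<open>If the first coordinate is already at most -1, nothing is left of the unit norm for the others.\<close>

lemma first_coord_le_imp_south_pole:
  assumes "p \<bullet> p \<le> 1" "1 + p$1 \<le> 0"
  shows "p = south_pole"
proof -
  have "1 \<le> (p$1)\<^sup>2"
    using assms(2) by (smt (verit) power2_minus one_le_power)
  moreover have le: "(p$1)\<^sup>2 + (p$2)\<^sup>2 + (p$3)\<^sup>2 + (p$4)\<^sup>2 \<le> 1"
    using assms(1) by (simp add: inner_4 power2_eq_square)
  ultimately have "(p$2)\<^sup>2 \<le> 0" "(p$3)\<^sup>2 \<le> 0" "(p$4)\<^sup>2 \<le> 0" "(p$1)\<^sup>2 \<le> 1"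
    by (smt (verit) zero_le_power2)+
  then have "p$2 = 0" "p$3 = 0" "p$4 = 0" "p$1 = -1"
    using assms(2) by (auto simp: abs_square_le_1)
  then show ?thesis
    by (simp add: vec_eq_iff forall_4 south_pole_nth)
qed

lemma punctured_S3D:
  assumes "p \<in> punctured_S3"
  shows "p \<in> S3" "p \<bullet> p = 1" "0 < 1 + p$1"
  using assms first_coord_le_imp_south_pole[of p]
  by (auto simp: punctured_S3_def mem_S3_iff not_le[symmetric])

text \<open>Stereographic projection is conformal: the Euclidean metric in $X, Y, Z$ is $(1+w)^{-2}$ times the
  round one. The identity follows from the sphere equation and the two tangency conditions, once
  the first components of \<open>u\<close> and \<open>v\<close> are written as multiples of $1+w$.\<close>

lemma coframe_orthonormal:
  assumes p: "p \<in> punctured_S3" and u: "u \<in> sphere_tangent p" and v: "v \<in> sphere_tangent p"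
  shows "coframe 2 p u * coframe 2 p v + coframe 3 p u * coframe 3 p v + coframe 4 p u * coframe 4 p v
    = u \<bullet> v"
proof -
  define k l where "k = u$1 / (1 + p$1)" and "l = v$1 / (1 + p$1)"
  have "u$1 = k * (1 + p$1)" "v$1 = l * (1 + p$1)"
    using punctured_S3D(3)[OF p] by (auto simp: k_def l_def)
  moreover have "p \<bullet> p = 1" "u \<bullet> p = 0" "v \<bullet> p = 0"
    using p u v by (auto dest: punctured_S3D sphere_tangentD)
  ultimately have "(u$2 - p$2*k) * (v$2 - p$2*l) + (u$3 - p$3*k) * (v$3 - p$3*l)
      + (u$4 - p$4*k) * (v$4 - p$4*l) = u \<bullet> v"
    unfolding inner_4 by algebra
  then show ?thesis
    by (simp add: coframe_def k_def l_def)
qed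

lemma unimodular_metric_0:
  assumes "p \<in> punctured_S3" "u \<in> sphere_tangent p" "v \<in> sphere_tangent p"
  shows "unimodular_metric 0 p u v = u \<bullet> v"
  using coframe_orthonormal[OF assms] by (simp add: unimodular_metric_def contact_form_def)

lemma differential_stereographic:
  assumes "1 + p$1 \<noteq> 0"
  shows "differential (\<lambda>q. c * q$i / (1 + q$1)) p u = c * coframe i p u / (1 + p$1)"
proof -
  have "((\<lambda>q. c * q$i / (1 + q$1)) has_derivative (\<lambda>u. c * coframe i p u / (1 + p$1))) (at p)"
    unfolding coframe_def
    by (rule derivative_eq_intros bounded_linear_imp_has_derivative bounded_linear_vec_nth refl assms)+
       (use assms in \<open>simp add: fun_eq_iff field_simps power2_eq_square\<close>)
  from frechet_derivative_at[OF this, symmetric] show ?thesis by simp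
qed

section \<open>The explicit boundary expression\<close>

text \<open>The factor $2/(1+w)^2$ comes from $d(2X) = 2\theta_2/(1+w)$ inside a square that is halved, and equally from
  the factor 2 in front of $dY^2 + dZ^2$.\<close>

lemma boundary_model_eq:
  assumes "p \<in> punctured_S3"
  shows "boundary_model b p u v = 2 / (1 + p$1)\<^sup>2 * unimodular_metric b p u v"
proof -
  have nz: "1 + p$1 \<noteq> 0" using punctured_S3D(3)[OF assms] by simp
  note d = differential_stereographic[OF nz, of 1, simplified] differential_stereographic[OF nz, of 2]
  have "boundary_form b p u = 2 / (1 + p$1) * contact_form b p u" for u
  proof -
    have "2 * A / s + b / 2 * (y / s) * (B / s) - b / 2 * (z / s) * (C / s)
      = 2 / s * (A + b / 4 * (y / s * B - z / s * C))" if "s \<noteq> 0" for s A B C y z :: real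
      using that by (simp add: field_simps)
    from this[OF nz] show ?thesis
      unfolding boundary_form_def contact_form_def d .
  qed
  then show ?thesis
    unfolding boundary_model_def unimodular_metric_def d
    by (simp add: power2_eq_square distrib_left)
qed

text \<open>In an orthonormal frame the coframe has an orthogonal matrix. The summand
  $\frac b4(Y\theta_4 - Z\theta_3)$ adds multiples of two columns to the remaining one and so does not
  change the determinant.\<close>

lemma det_unimodular:
  assumes p: "p \<in> punctured_S3"
    and e: "\<And>i. e i \<in> sphere_tangent p" "\<And>i j. e i \<bullet> e j = (if i = j then 1 else 0)"
  shows "det (\<chi> i j. unimodular_metric b p (e i) (e j) :: real^3^3) = 1"
proof -
  \<comment> \<open>The columns of \<open>T\<close> and of \<open>A\<close> are the coframes of the round metric and of \<open>g\<^sub>b\<close>.\<close>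
  define T :: "real^3^3" where
    "T = (\<chi> i k. if k = 1 then coframe 2 p (e i) else if k = 2 then coframe 3 p (e i) else coframe 4 p (e i))"
  define A :: "real^3^3" where
    "A = (\<chi> i k. if k = 1 then contact_form b p (e i) else if k = 2 then coframe 3 p (e i) else coframe 4 p (e i))"
  have "(\<chi> i j. unimodular_metric b p (e i) (e j)) = A ** transpose A"
    by (simp add: vec_eq_iff matrix_matrix_mult_def transpose_def sum_3 A_def unimodular_metric_def)
  then have "det (\<chi> i j. unimodular_metric b p (e i) (e j) :: real^3^3) = (det A)\<^sup>2"
    by (simp add: det_mul power2_eq_square)
  also have "det A = det T"
    unfolding det_3 A_def T_def contact_form_def by (simp add: algebra_simps)
  also have "(det T)\<^sup>2 = det (T ** transpose T)"
    by (simp add: det_mul power2_eq_square)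
  also have "T ** transpose T = mat 1"
    using coframe_orthonormal[OF p e(1) e(1)] e(2)
    by (simp add: vec_eq_iff matrix_matrix_mult_def transpose_def sum_3 T_def mat_def)
  finally show ?thesis by simp
qed

section \<open>The limit of the rescaled metric at the boundary\<close>

text \<open>The factor $4\rho^2$ cancels the pole of the metric. What remains is regular at $\rho = 0$, where the
  rational coefficients take the values 2, 1/2 and 4; the first of them is multiplied by the
  product of the $d\rho$-components, which tends to 0.\<close>

lemma rescaled_h_metric_tendsto:
  assumes "(\<rho> \<longlongrightarrow> 0) F" "\<forall>\<^sub>F q in F. \<rho> q \<noteq> 0" "(\<zeta> \<longlongrightarrow> \<zeta>0) F" "(\<eta> \<longlongrightarrow> \<eta>0) F"
    and "(d\<rho> \<longlongrightarrow> 0) F" "(d\<phi> \<longlongrightarrow> d\<phi>0) F" "(d\<zeta> \<longlongrightarrow> d\<zeta>0) F" "(d\<eta> \<longlongrightarrow> d\<eta>0) F"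
    and "(d\<rho>' \<longlongrightarrow> 0) F" "(d\<phi>' \<longlongrightarrow> d\<phi>1) F" "(d\<zeta>' \<longlongrightarrow> d\<zeta>1) F" "(d\<eta>' \<longlongrightarrow> d\<eta>1) F"
  shows "((\<lambda>q. 4 * (\<rho> q)\<^sup>2 * h_metric b (\<rho> q, \<phi> q, \<zeta> q, \<eta> q)
                 (d\<rho> q, d\<phi> q, d\<zeta> q, d\<eta> q) (d\<rho>' q, d\<phi>' q, d\<zeta>' q, d\<eta>' q))
     \<longlongrightarrow> 1 / 2 * ((d\<phi>0 + b * \<zeta>0 * d\<eta>0 - b * \<eta>0 * d\<zeta>0) * (d\<phi>1 + b * \<zeta>0 * d\<eta>1 - b * \<eta>0 * d\<zeta>1))
        + 4 * (d\<eta>0 * d\<eta>1 + d\<zeta>0 * d\<zeta>1)) F"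
proof (rule Lim_transform_eventually)
  show "((\<lambda>q. (b * \<rho> q + 2) / (b * \<rho> q + 1) * (d\<rho> q * d\<rho>' q)
        + (b * \<rho> q + 1) / (b * \<rho> q + 2)
            * ((d\<phi> q + b * \<zeta> q * d\<eta> q - b * \<eta> q * d\<zeta> q) * (d\<phi>' q + b * \<zeta> q * d\<eta>' q - b * \<eta> q * d\<zeta>' q))
        + 2 * (b * \<rho> q + 2) * (d\<eta> q * d\<eta>' q + d\<zeta> q * d\<zeta>' q))
     \<longlongrightarrow> 1 / 2 * ((d\<phi>0 + b * \<zeta>0 * d\<eta>0 - b * \<eta>0 * d\<zeta>0) * (d\<phi>1 + b * \<zeta>0 * d\<eta>1 - b * \<eta>0 * d\<zeta>1))
        + 4 * (d\<eta>0 * d\<eta>1 + d\<zeta>0 * d\<zeta>1)) F"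
    by (rule tendsto_eq_intros assms refl | simp)+
qed (use assms(2) in eventually_elim, simp)

definition ball_denom_deriv :: "real^4 \<Rightarrow> real^4 \<Rightarrow> real" where
  "ball_denom_deriv q u = 2 * ((1 + q$1) * u$1 + q$2 * u$2 + q$3 * u$3 + q$4 * u$4)"

lemma has_derivative_ball_denom: "(ball_denom has_derivative ball_denom_deriv q) (at q)"
  unfolding ball_denom_def[abs_def]
  by (rule derivative_eq_intros bounded_linear_imp_has_derivative bounded_linear_vec_nth refl)+
     (simp add: fun_eq_iff ball_denom_deriv_def algebra_simps)

lemma ball_denom_pos:
  assumes "q \<noteq> south_pole"
  shows "0 < ball_denom q"
proof -
  have "ball_denom q \<noteq> 0"
    using assms by (auto simp: ball_denom_def vec_eq_iff forall_4 south_pole_nth add_nonneg_eq_0_iff)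
  then show ?thesis by (simp add: ball_denom_def less_le)
qed

lemma ball_rho_eq: "ball_rho q = (1 - q \<bullet> q) / ball_denom q"
  by (simp add: ball_rho_def inner_4 power2_eq_square)

text \<open>The quotient rule for numerators over \<open>ball_denom\<close>: \<open>f\<close> is the value of the numerator at \<open>q\<close>, and
  \<open>f'\<close> that of its differential at \<open>u\<close>.\<close>

definition ball_quotient_deriv :: "real^4 \<Rightarrow> real^4 \<Rightarrow> real \<Rightarrow> real \<Rightarrow> real" where
  "ball_quotient_deriv q u f f' = (f' * ball_denom q - f * ball_denom_deriv q u) / (ball_denom q)\<^sup>2"

lemma frechet_derivative_ball_coords:
  assumes "ball_denom q \<noteq> 0"
  shows "frechet_derivative ball_coords (at q) u =
     (ball_quotient_deriv q u (1 - q \<bullet> q) (- 2 * (q \<bullet> u)),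
      ball_quotient_deriv q u (4 * q$2) (4 * u$2),
      ball_quotient_deriv q u (sqrt 2 * q$3) (sqrt 2 * u$3),
      ball_quotient_deriv q u (sqrt 2 * q$4) (sqrt 2 * u$4))"
proof -
  have quotient: "((\<lambda>q. f q / ball_denom q) has_derivative (\<lambda>u. ball_quotient_deriv q u (f q) (f' u))) (at q)"
    if "(f has_derivative f') (at q)" for f f'
    by (rule derivative_eq_intros that has_derivative_ball_denom refl assms)+
       (use assms in \<open>simp add: ball_quotient_deriv_def fun_eq_iff field_simps power2_eq_square\<close>)
  have nth: "((\<lambda>q. c * q $ i) has_derivative (\<lambda>u. c * u $ i)) (at q)" for c :: real and i :: 4
    by (intro bounded_linear_imp_has_derivative bounded_linear_mult_right[THEN bounded_linear_compose]
        bounded_linear_vec_nth)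
  have norm: "((\<lambda>q. 1 - q \<bullet> q) has_derivative (\<lambda>u. - 2 * (q \<bullet> u))) (at q)"
    by (rule derivative_eq_intros refl)+ (simp add: fun_eq_iff inner_commute)
  from quotient[OF norm] quotient[OF nth] quotient[OF nth] quotient[OF nth]
  have "(ball_coords has_derivative (\<lambda>u.
     (ball_quotient_deriv q u (1 - q \<bullet> q) (- 2 * (q \<bullet> u)),
      ball_quotient_deriv q u (4 * q$2) (4 * u$2),
      ball_quotient_deriv q u (sqrt 2 * q$3) (sqrt 2 * u$3),
      ball_quotient_deriv q u (sqrt 2 * q$4) (sqrt 2 * u$4)))) (at q)"
    unfolding ball_coords_def[abs_def] ball_rho_eq by (intro has_derivative_Pair)
  from frechet_derivative_at[OF this, symmetric] show ?thesis by simp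
qed

text \<open>On tangent vectors at a boundary point, $N = 2(1+w)$ and $dN = 2\,dw$, just as if $N$ were
  $2(1+w)$ itself. So the differentials of the coordinates other than $\rho'$ become those of
  $2X$, $Y/\sqrt 2$ and $Z/\sqrt 2$, while that of $\rho'$ tends to 0, as its numerator $1 - |q|^2$ and the
  differential of that numerator both do.\<close>

lemma boundary_metric_eq:
  assumes p: "p \<in> punctured_S3" and u: "u \<in> sphere_tangent p" and v: "v \<in> sphere_tangent p"
  shows "boundary_metric b p u v = 2 / (1 + p$1)\<^sup>2 * unimodular_metric b p u v"
proof -
  let ?F = "at p within ball 0 1"
  have r: "0 < 1 + p$1" and pp: "p \<bullet> p = 1" using punctured_S3D[OF p] by auto
  then have nz: "1 + p$1 \<noteq> 0" by simp
  have denom: "ball_denom p = 2 * (1 + p$1)"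
    using pp unfolding ball_denom_def inner_4 by algebra
  have deriv: "ball_denom_deriv p t = 2 * t$1" if "t \<in> sphere_tangent p" for t
    using sphere_tangentD[OF that] unfolding ball_denom_deriv_def inner_4 by algebra
  have "p \<in> cball 0 1" using pp by (simp add: norm_eq_sqrt_inner)
  then have nontrivial: "?F \<noteq> bot"
    by (auto simp: at_within_ball_bot_iff)
  have inside: "\<forall>\<^sub>F q in ?F. q \<in> ball 0 1"
    by (simp add: eventually_at_filter)
  have interior: "0 < ball_denom q \<and> 0 < ball_rho q" if "q \<in> ball 0 1" for q
  proof -
    have "q \<bullet> q < 1"
      using that by (simp add: norm_lt_square)
    moreover from this have "q \<noteq> south_pole"
      by (auto simp: inner_4 south_pole_nth)
    ultimately show ?thesis
      using ball_denom_pos[of q] by (simp add: ball_rho_eq)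
  qed
  have lim_id: "((\<lambda>q. q) \<longlongrightarrow> p) ?F" by (rule tendsto_ident_at)
  have lim_denom: "(ball_denom \<longlongrightarrow> 2 * (1 + p$1)) ?F"
    unfolding denom[symmetric] ball_denom_def[abs_def] by (intro tendsto_intros)
  have lim_quotient: "((\<lambda>q. f q / ball_denom q) \<longlongrightarrow> c / (2 * (1 + p$1))) ?F"
    if "(f \<longlongrightarrow> c) ?F" for f c
    using r by (intro tendsto_divide that lim_denom) simp
  have lim_deriv: "((\<lambda>q. ball_quotient_deriv q t (f q) (f' q)) \<longlongrightarrow>
      (c' * (2 * (1 + p$1)) - c * (2 * t$1)) / (2 * (1 + p$1))\<^sup>2) ?F"
    if "t \<in> sphere_tangent p" "(f \<longlongrightarrow> c) ?F" "(f' \<longlongrightarrow> c') ?F" for t f f' c c'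
    unfolding ball_quotient_deriv_def deriv[OF that(1), symmetric] ball_denom_deriv_def
    using r by (intro tendsto_intros that lim_denom) simp
  have lim_nth: "((\<lambda>q. c * q $ i) \<longlongrightarrow> c * p $ i) ?F" for c i
    by (intro tendsto_intros)
  have lim_sq: "((\<lambda>q. 1 - q \<bullet> q) \<longlongrightarrow> 0) ?F"
    using tendsto_diff[OF tendsto_const tendsto_inner[OF lim_id lim_id], of 1] by (simp add: pp)
  have lim_rho: "(ball_rho \<longlongrightarrow> 0) ?F"
    using lim_quotient[OF lim_sq] by (simp add: ball_rho_eq[abs_def])
  have lim_drho: "((\<lambda>q. ball_quotient_deriv q t (1 - q \<bullet> q) (- 2 * (q \<bullet> t))) \<longlongrightarrow> 0) ?F"
    if t: "t \<in> sphere_tangent p" for t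
  proof -
    have "((\<lambda>q. - 2 * (q \<bullet> t)) \<longlongrightarrow> 0) ?F"
      using tendsto_mult[OF tendsto_const tendsto_inner[OF lim_id tendsto_const], of "-2" t]
      by (simp add: inner_commute[of p] sphere_tangentD[OF t])
    from lim_deriv[OF t lim_sq this] show ?thesis by simp
  qed
  note lim_dcoord = lim_deriv[OF _ lim_nth tendsto_const]
  have rho_nz: "\<forall>\<^sub>F q in ?F. ball_rho q \<noteq> 0"
    using inside by eventually_elim (use interior in force)
  \<comment> \<open>The limit of \<open>ball_quotient_deriv q t (c * q$i) (c * t$i)\<close>.\<close>
  define d where "d = (\<lambda>c t i. (c * t$i * (2 * (1 + p$1)) - c * p$i * (2 * t$1)) / (2 * (1 + p$1))\<^sup>2)"
  have d_eq: "d c t i = c * coframe i p t / (2 * (1 + p$1))" for c t i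
  proof -
    have "(c * x * (2 * s) - c * y * (2 * z)) / (2 * s)\<^sup>2 = c * (x - y * z / s) / (2 * s)" if "s \<noteq> 0" for x y z s
      using that by (simp add: field_simps power2_eq_square)
    then show ?thesis
      unfolding d_def coframe_def using nz .
  qed
  let ?contact = "\<lambda>t. d 4 t 2 + b * (sqrt 2 * p$3 / (2 * (1 + p$1))) * d (sqrt 2) t 4
      - b * (sqrt 2 * p$4 / (2 * (1 + p$1))) * d (sqrt 2) t 3"
  let ?coords = "\<lambda>q. (ball_rho q, 4 * q$2 / ball_denom q,
      sqrt 2 * q$3 / ball_denom q, sqrt 2 * q$4 / ball_denom q)"
  let ?dcoords = "\<lambda>q t. (ball_quotient_deriv q t (1 - q \<bullet> q) (- 2 * (q \<bullet> t)),
         ball_quotient_deriv q t (4 * q$2) (4 * t$2),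
         ball_quotient_deriv q t (sqrt 2 * q$3) (sqrt 2 * t$3),
         ball_quotient_deriv q t (sqrt 2 * q$4) (sqrt 2 * t$4))"
  have "((\<lambda>q. 4 * (ball_rho q)\<^sup>2 * h_ball b q u v) \<longlongrightarrow>
     1 / 2 * (?contact u * ?contact v) + 4 * (d (sqrt 2) u 4 * d (sqrt 2) v 4 + d (sqrt 2) u 3 * d (sqrt 2) v 3)) ?F"
    (is "(_ \<longlongrightarrow> ?L) _")
  proof (rule Lim_transform_eventually)
    show "((\<lambda>q. 4 * (ball_rho q)\<^sup>2 * h_metric b (?coords q) (?dcoords q u) (?dcoords q v)) \<longlongrightarrow> ?L) ?F"
      unfolding d_def
      by (intro rescaled_h_metric_tendsto lim_rho rho_nz lim_quotient lim_nth lim_drho lim_dcoord u v)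
    show "\<forall>\<^sub>F q in ?F. 4 * (ball_rho q)\<^sup>2 * h_metric b (?coords q) (?dcoords q u) (?dcoords q v) = 4 * (ball_rho q)\<^sup>2 * h_ball b q u v"
      using inside
    proof eventually_elim
      case (elim q)
      then have "ball_denom q \<noteq> 0" using interior by force
      from frechet_derivative_ball_coords[OF this] show ?case
        by (simp only: h_ball_def pullback_def ball_coords_def)
    qed
  qed
  then have limit: "boundary_metric b p u v = ?L"
    unfolding boundary_metric_def by (rule tendsto_Lim[OF nontrivial])
  have half: "(sqrt 2 * x / (2 * s)) * (sqrt 2 * y / (2 * s)) = (x * y / s\<^sup>2) / 2" for x y s
  proof -
    have "(sqrt 2 * x) * (sqrt 2 * y) = (sqrt 2)\<^sup>2 * (x * y)"
      by (simp only: power2_eq_square ac_simps)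
    then have "(sqrt 2 * x) * (sqrt 2 * y) = 2 * (x * y)" by simp
    moreover have "(2 * s) * (2 * s) = 2 * (2 * s\<^sup>2)"
      by (simp add: power2_eq_square)
    ultimately show ?thesis
      by (simp only: times_divide_times_eq) simp
  qed
  have contact: "?contact t = 2 / (1 + p$1) * contact_form b p t" for t
  proof -
    have "4 * A / (2 * s) + b * (y * B / s\<^sup>2 / 2) - b * (z * C / s\<^sup>2 / 2)
      = 2 / s * (A + b / 4 * (y / s * B - z / s * C))" if "s \<noteq> 0" for s A B C y z :: real
      using that by (simp add: field_simps power2_eq_square)
    then show ?thesis
      unfolding d_eq mult.assoc[of b] half contact_form_def using nz .
  qed
  have "1 / 2 * ((2 / s * A) * (2 / s * A')) + 4 * (z * z' / s\<^sup>2 / 2 + y * y' / s\<^sup>2 / 2)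
    = 2 / s\<^sup>2 * (A * A' + y * y' + z * z')" for s A A' y y' z z' :: real
    by (simp add: power2_eq_square algebra_simps add_divide_distrib)
  then show ?thesis
    unfolding limit contact unfolding unimodular_metric_def d_eq half .
qed

section \<open>Conformal classes on the punctured sphere\<close>

lemma conformal_class_eqI:
  assumes pos: "\<And>p. p \<in> X \<Longrightarrow> 0 < c p"
    and eq: "\<And>p u v. p \<in> X \<Longrightarrow> u \<in> sphere_tangent p \<Longrightarrow> v \<in> sphere_tangent p \<Longrightarrow> g p u v = c p * h p u v"
  shows "conformal_class X g = conformal_class X h"
proof (intro equalityI subsetI)
  fix k assume "k \<in> conformal_class X g"
  then obtain f where "\<forall>p\<in>X. 0 < f p"
    "\<forall>p\<in>X. \<forall>u\<in>sphere_tangent p. \<forall>v\<in>sphere_tangent p. k p u v = f p * g p u v"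
    by (auto simp: conformal_class_def)
  then show "k \<in> conformal_class X h"
    unfolding conformal_class_def using pos eq
    by (intro CollectI exI[of _ "\<lambda>p. f p * c p"]) simp
next
  fix k assume "k \<in> conformal_class X h"
  then obtain f where "\<forall>p\<in>X. 0 < f p"
    "\<forall>p\<in>X. \<forall>u\<in>sphere_tangent p. \<forall>v\<in>sphere_tangent p. k p u v = f p * h p u v"
    by (auto simp: conformal_class_def)
  then show "k \<in> conformal_class X g"
    unfolding conformal_class_def using pos eq
    by (intro CollectI exI[of _ "\<lambda>p. f p / c p"]) (auto simp: less_imp_neq[OF pos, symmetric])
qed

lemma boundary_class_eq_unimodular:
  "conformal_class punctured_S3 (boundary_metric b) = conformal_class punctured_S3 (unimodular_metric b)"
  by (rule conformal_class_eqI[where c = "\<lambda>p. 2 / (1 + p$1)\<^sup>2"])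
     (auto simp: boundary_metric_eq dest: punctured_S3D(3))

lemma model_class_eq_unimodular:
  "conformal_class punctured_S3 (boundary_model b) = conformal_class punctured_S3 (unimodular_metric b)"
  by (rule conformal_class_eqI[where c = "\<lambda>p. 2 / (1 + p$1)\<^sup>2"])
     (auto simp: boundary_model_eq dest: punctured_S3D(3))

section \<open>Approach to the south pole along a meridian\<close>

text \<open>Points of the meridian $x = z = 0$ that tend to the south pole, in the rational parametrisation of the
  circle: the parameter $n$ is the stereographic coordinate $Y = y/(1+w)$.\<close>

definition polar_curve :: "nat \<Rightarrow> real^4" where
  "polar_curve n = (\<chi> i. if i = 1 then (1 - (real n)\<^sup>2) / (1 + (real n)\<^sup>2)
                         else if i = 3 then 2 * real n / (1 + (real n)\<^sup>2) else 0)"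

lemma one_plus_square_pos: "0 < 1 + (real n)\<^sup>2"
  by (simp add: add_pos_nonneg)

lemma polar_curve_nth:
  "1 + polar_curve n $ 1 = 2 / (1 + (real n)\<^sup>2)" "polar_curve n $ 2 = 0"
  "polar_curve n $ 3 = 2 * real n / (1 + (real n)\<^sup>2)" "polar_curve n $ 4 = 0"
  using one_plus_square_pos[of n] by (simp_all add: polar_curve_def field_simps)

lemma polar_curve_mem: "polar_curve n \<in> punctured_S3"
proof -
  have "((1 - (real n)\<^sup>2) / (1 + (real n)\<^sup>2))\<^sup>2 + (2 * real n / (1 + (real n)\<^sup>2))\<^sup>2 = 1"
    using one_plus_square_pos[of n]
    by (simp add: power_divide add_divide_distrib[symmetric] divide_eq_eq) algebra
  then have "polar_curve n \<bullet> polar_curve n = 1"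
    by (simp add: inner_4 polar_curve_def power2_eq_square)
  moreover have "polar_curve n $ 1 \<noteq> -1"
    using polar_curve_nth(1)[of n] one_plus_square_pos[of n] by auto
  then have "polar_curve n \<noteq> south_pole"
    by (auto simp: south_pole_nth)
  ultimately show ?thesis
    by (simp add: punctured_S3_def mem_S3_iff)
qed

lemma polar_curve_tendsto: "polar_curve \<longlonglongrightarrow> south_pole"
proof (rule vec_tendstoI)
  fix i :: 4
  have "(\<lambda>n. (1 - (real n)\<^sup>2) / (1 + (real n)\<^sup>2)) \<longlonglongrightarrow> -1" "(\<lambda>n. 2 * real n / (1 + (real n)\<^sup>2)) \<longlonglongrightarrow> 0"
    by real_asymp+
  then show "(\<lambda>n. polar_curve n $ i) \<longlonglongrightarrow> south_pole $ i"
    by (cases "i = 1"; cases "i = 3") (auto simp: polar_curve_def south_pole_nth)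
qed

lemma polar_curve_tangents:
  "axis 2 1 \<in> sphere_tangent (polar_curve n)" "axis 4 1 \<in> sphere_tangent (polar_curve n)"
  by (simp_all add: sphere_tangent_def inner_axis' polar_curve_nth)

lemma south_pole_tangents: "axis 2 1 \<in> sphere_tangent south_pole" "axis 4 1 \<in> sphere_tangent south_pole"
  by (simp_all add: sphere_tangent_def inner_axis' south_pole_nth)

text \<open>These two vectors are constant along the curve and separate the behaviour of $g_b$: the first has
  only a $\theta_2$-component, the second only a $\theta_4$-component, which enters the contact form with
  the coefficient $bY/4 = bn/4$.\<close>

lemma unimodular_metric_polar_curve:
  "unimodular_metric b (polar_curve n) (axis 2 1) (axis 2 1) = 1"
  "unimodular_metric b (polar_curve n) (axis 4 1) (axis 4 1) = 1 + (b * n / 4)\<^sup>2"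
proof -
  have "polar_curve n $ 3 / (1 + polar_curve n $ 1) = n"
    using one_plus_square_pos[of n] by (simp add: polar_curve_nth)
  then show "unimodular_metric b (polar_curve n) (axis 2 1) (axis 2 1) = 1"
    "unimodular_metric b (polar_curve n) (axis 4 1) (axis 4 1) = 1 + (b * n / 4)\<^sup>2"
    by (simp_all add: unimodular_metric_def contact_form_def coframe_def axis_def power2_eq_square)
qed

lemma dist_south_pole_square:
  assumes "p \<in> S3"
  shows "(dist p south_pole)\<^sup>2 = 2 * (1 + p$1)"
proof -
  have "(dist p south_pole)\<^sup>2 = (p - south_pole) \<bullet> (p - south_pole)"
    by (simp add: dist_norm power2_norm_eq_inner)
  also have "\<dots> = p \<bullet> p + 2 * p$1 + 1"
    by (simp add: inner_4 south_pole_nth algebra_simps)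
  finally show ?thesis using assms by (simp add: mem_S3_iff)
qed

lemma continuous_metric_tendsto:
  assumes "continuous_metric_on S3 G" "\<And>n. p n \<in> S3" "q \<in> S3" "p \<longlonglongrightarrow> q"
    and "\<And>n. u n \<in> sphere_tangent (p n)" "u' \<in> sphere_tangent q" "u \<longlonglongrightarrow> u'"
    and "\<And>n. v n \<in> sphere_tangent (p n)" "v' \<in> sphere_tangent q" "v \<longlonglongrightarrow> v'"
  shows "(\<lambda>n. G (p n) (u n) (v n)) \<longlonglongrightarrow> G q u' v'"
proof -
  let ?S = "{(p, u, v). p \<in> S3 \<and> u \<in> sphere_tangent p \<and> v \<in> sphere_tangent p}"
  have "(\<lambda>n. (p n, u n, v n)) \<longlonglongrightarrow> (q, u', v')"
    by (intro tendsto_Pair assms)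
  from continuous_on_tendsto_compose[where s = ?S and f = "\<lambda>(p, u, v). G p u v", OF _ this]
  show ?thesis
    using assms by (simp add: continuous_metric_on_def)
qed

lemma south_pole_S3: "south_pole \<in> S3"
  by (simp add: mem_S3_iff inner_4 south_pole_nth)

lemma polar_curve_S3: "polar_curve n \<in> S3"
  using polar_curve_mem by (simp add: punctured_S3_def)

lemma continuous_metric_south_pole_pos:
  assumes "continuous_metric_on S3 G"
  shows "0 < G south_pole (axis 2 1) (axis 2 1)"
  using assms south_pole_S3 south_pole_tangents(1)
  by (auto simp: continuous_metric_on_def axis_eq_0_iff)

section \<open>The singularity for positive parameter\<close>

text \<open>A conformal factor cancels in the ratio of the squared lengths of two vectors. In a continuous metric the
  ratio along the curve would converge, because the vectors are constant, tangent and nonzero at the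
  south pole; here it tends to infinity.\<close>

lemma no_metric_extension:
  assumes "0 < b"
  shows "metric_extensions (conformal_class punctured_S3 (unimodular_metric b)) = {}"
proof (rule equals0I)
  fix G assume "G \<in> metric_extensions (conformal_class punctured_S3 (unimodular_metric b))"
  then have G: "continuous_metric_on S3 G" and mem: "G \<in> conformal_class punctured_S3 (unimodular_metric b)"
    by (simp_all add: metric_extensions_def)
  from mem obtain f where f: "\<forall>p\<in>punctured_S3. \<forall>u\<in>sphere_tangent p. \<forall>v\<in>sphere_tangent p.
      G p u v = f p * unimodular_metric b p u v"
    by (auto simp: conformal_class_def)
  let ?a = "\<lambda>n. G (polar_curve n) (axis 2 1) (axis 2 1)"
  let ?c = "\<lambda>n. G (polar_curve n) (axis 4 1) (axis 4 1)"
  have ratio: "?c n = ?a n * (1 + (b * n / 4)\<^sup>2)" for n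
    by (simp add: f polar_curve_mem polar_curve_tangents unimodular_metric_polar_curve)
  have "?a \<longlonglongrightarrow> G south_pole (axis 2 1) (axis 2 1)"
    by (intro continuous_metric_tendsto G polar_curve_S3 south_pole_S3 polar_curve_tendsto
        polar_curve_tangents south_pole_tangents tendsto_const)
  moreover have "filterlim (\<lambda>n. 1 + (b * real n / 4)\<^sup>2) at_top sequentially"
    using assms by real_asymp
  ultimately have "filterlim ?c at_top sequentially"
    unfolding ratio using continuous_metric_south_pole_pos[OF G]
    by (intro filterlim_tendsto_pos_mult_at_top)
  moreover have "?c \<longlonglongrightarrow> G south_pole (axis 4 1) (axis 4 1)"
    by (intro continuous_metric_tendsto G polar_curve_S3 south_pole_S3 polar_curve_tendsto
        polar_curve_tangents south_pole_tangents tendsto_const)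
  ultimately show False
    using not_tendsto_and_filterlim_at_infinity filterlim_at_top_imp_at_infinity trivial_limit_sequentially by blast
qed

lemma abs_coframe_le:
  assumes "p \<in> punctured_S3" "u \<in> sphere_tangent p"
  shows "\<bar>coframe 2 p u\<bar> \<le> norm u" "\<bar>coframe 3 p u\<bar> \<le> norm u" "\<bar>coframe 4 p u\<bar> \<le> norm u"
proof -
  have "(coframe 2 p u)\<^sup>2 + (coframe 3 p u)\<^sup>2 + (coframe 4 p u)\<^sup>2 = (norm u)\<^sup>2"
    using coframe_orthonormal[OF assms(1) assms(2) assms(2)]
    by (simp add: power2_norm_eq_inner) (simp add: power2_eq_square)
  then have "(coframe i p u)\<^sup>2 \<le> (norm u)\<^sup>2" if "i \<in> {2, 3, 4}" for i
    using that by (smt (verit) insert_iff empty_iff zero_le_power2)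
  then show "\<bar>coframe 2 p u\<bar> \<le> norm u" "\<bar>coframe 3 p u\<bar> \<le> norm u" "\<bar>coframe 4 p u\<bar> \<le> norm u"
    by (simp_all add: abs_le_square_iff[of _ "norm u", simplified])
qed

text \<open>Each coordinate of \<open>p\<close> but the first vanishes at the south pole, so it is at most the distance $d$
  to it, while $1 + w = d^2/2$.\<close>

lemma dist_times_stereographic_le:
  assumes p: "p \<in> punctured_S3" and i: "i \<noteq> 1"
  shows "dist p south_pole * \<bar>p$i / (1 + p$1)\<bar> \<le> 2"
proof -
  have r: "0 < 1 + p$1" using punctured_S3D[OF p] by simp
  have "\<bar>p$i\<bar> \<le> dist p south_pole"
    using component_le_norm_cart[of "p - south_pole" i] i by (simp add: dist_norm south_pole_nth)
  then have "dist p south_pole * \<bar>p$i\<bar> \<le> (dist p south_pole)\<^sup>2"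
    by (simp add: power2_eq_square mult_left_mono)
  then show ?thesis
    using r dist_south_pole_square[OF punctured_S3D(1)[OF p]] by (simp add: abs_divide field_simps)
qed

lemma dist_south_pole_le: "dist p south_pole \<le> 2" if "p \<in> S3"
  using dist_triangle[of p south_pole 0] that south_pole_S3 by (simp add: S3_def dist_commute)

lemma abs_contact_form_le:
  assumes p: "p \<in> punctured_S3" and u: "u \<in> sphere_tangent p" and b: "0 \<le> b"
  shows "dist p south_pole * \<bar>contact_form b p u\<bar> \<le> (2 + b) * norm u"
proof -
  let ?d = "dist p south_pole" and ?Y = "p$3 / (1 + p$1)" and ?Z = "p$4 / (1 + p$1)"
  have "?d * \<bar>contact_form b p u\<bar>
    \<le> ?d * (\<bar>coframe 2 p u\<bar> + b / 4 * (\<bar>?Y\<bar> * \<bar>coframe 4 p u\<bar> + \<bar>?Z\<bar> * \<bar>coframe 3 p u\<bar>))"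
    unfolding contact_form_def abs_mult[symmetric] using b
    by (intro mult_left_mono order_trans[OF abs_triangle_ineq] add_mono order_refl)
       (auto simp: abs_mult intro!: mult_left_mono order_trans[OF abs_triangle_ineq4])
  also have "\<dots> = ?d * \<bar>coframe 2 p u\<bar>
      + b / 4 * ((?d * \<bar>?Y\<bar>) * \<bar>coframe 4 p u\<bar> + (?d * \<bar>?Z\<bar>) * \<bar>coframe 3 p u\<bar>)"
    by (simp add: algebra_simps)
  also have "\<dots> \<le> 2 * norm u + b / 4 * (2 * norm u + 2 * norm u)"
    using b abs_coframe_le[OF p u] dist_times_stereographic_le[OF p] dist_south_pole_le[OF punctured_S3D(1)[OF p]]
    by (intro add_mono mult_mono) auto
  finally show ?thesis by (simp add: algebra_simps)
qed

text \<open>One factor $d$ of $d^2$ goes to each one-form of a product. The contact form contributes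
  $(2+b)^2$ to the constant, and each of the two other squares contributes 4 because $d \le 2$.\<close>

lemma growth_at_most_2:
  assumes "0 \<le> b"
  shows "growth_at_most punctured_S3 south_pole (unimodular_metric b) 2"
  unfolding growth_at_most_def
proof (intro exI[of _ "(2 + b)\<^sup>2 + 8"] eventually_at_filter[THEN iffD2] always_eventually allI impI ballI)
  fix p u v assume p: "p \<in> punctured_S3" and u: "u \<in> sphere_tangent p" and v: "v \<in> sphere_tangent p"
  let ?d = "dist p south_pole"
  have coframe: "?d * \<bar>coframe i p t\<bar> \<le> 2 * norm t" if "i \<in> {3, 4}" "t \<in> sphere_tangent p" for i t
    using that abs_coframe_le[OF p that(2)] dist_south_pole_le[OF punctured_S3D(1)[OF p]]
    by (intro mult_mono) auto
  have prod: "(?d * \<bar>x\<bar>) * (?d * \<bar>y\<bar>) \<le> k * norm u * (k * norm v)"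
    if "?d * \<bar>x\<bar> \<le> k * norm u" "?d * \<bar>y\<bar> \<le> k * norm v" "0 \<le> k" for x y k
    using that by (intro mult_mono[OF that(1,2)]) auto
  have "?d\<^sup>2 * \<bar>unimodular_metric b p u v\<bar>
    \<le> ?d\<^sup>2 * (\<bar>contact_form b p u * contact_form b p v\<bar> + \<bar>coframe 3 p u * coframe 3 p v\<bar>
        + \<bar>coframe 4 p u * coframe 4 p v\<bar>)"
    unfolding unimodular_metric_def by (intro mult_left_mono) auto
  also have "\<dots> = (?d * \<bar>contact_form b p u\<bar>) * (?d * \<bar>contact_form b p v\<bar>)
      + (?d * \<bar>coframe 3 p u\<bar>) * (?d * \<bar>coframe 3 p v\<bar>)
      + (?d * \<bar>coframe 4 p u\<bar>) * (?d * \<bar>coframe 4 p v\<bar>)"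
    by (simp add: abs_mult power2_eq_square algebra_simps)
  also have "\<dots> \<le> (2 + b) * norm u * ((2 + b) * norm v) + 2 * norm u * (2 * norm v) + 2 * norm u * (2 * norm v)"
    using assms by (intro add_mono prod abs_contact_form_le coframe p u v) auto
  also have "\<dots> = ((2 + b)\<^sup>2 + 8) * norm u * norm v"
    by (simp add: power2_eq_square algebra_simps)
  finally show "?d\<^sup>2 * \<bar>unimodular_metric b p u v\<bar> \<le> ((2 + b)\<^sup>2 + 8) * norm u * norm v" .
qed

text \<open>Along the curve, $d = 2/\sqrt{1+n^2}$, while the squared length of the fourth coordinate vector grows like
  $n^2$.\<close>

lemma not_growth_at_most_less_2:
  assumes "0 < b" "m < 2"
  shows "\<not> growth_at_most punctured_S3 south_pole (unimodular_metric b) m"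
proof
  assume "growth_at_most punctured_S3 south_pole (unimodular_metric b) m"
  then obtain K where K: "\<forall>\<^sub>F p in at south_pole within punctured_S3.
      \<forall>u\<in>sphere_tangent p. \<forall>v\<in>sphere_tangent p.
        dist p south_pole ^ m * \<bar>unimodular_metric b p u v\<bar> \<le> K * norm u * norm v"
    by (auto simp: growth_at_most_def)
  have "filterlim polar_curve (at south_pole within punctured_S3) sequentially"
    unfolding filterlim_at using polar_curve_tendsto polar_curve_mem
    by (auto simp: punctured_S3_def)
  from eventually_compose_filterlim[OF K this]
  have bounded: "\<forall>\<^sub>F n in sequentially. dist (polar_curve n) south_pole ^ m * (1 + (b * n / 4)\<^sup>2) \<le> K"
  proof eventually_elim
    case (elim n)
    then have "dist (polar_curve n) south_pole ^ m
        * \<bar>unimodular_metric b (polar_curve n) (axis 4 1) (axis 4 1)\<bar> \<le> K * norm (axis 4 1 :: real^4) * norm (axis 4 1 :: real^4)"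
      using polar_curve_tangents(2) by blast
    then show ?case
      by (simp add: unimodular_metric_polar_curve norm_axis_1 abs_of_pos add_pos_nonneg)
  qed
  have "dist (polar_curve n) south_pole = 2 / sqrt (1 + (real n)\<^sup>2)" for n
  proof -
    have "(dist (polar_curve n) south_pole)\<^sup>2 = 4 / (1 + (real n)\<^sup>2)"
      by (simp add: dist_south_pole_square polar_curve_S3 polar_curve_nth)
    then show ?thesis
      by (metis abs_of_nonneg real_sqrt_abs real_sqrt_divide real_sqrt_four zero_le_dist)
  qed
  moreover have "filterlim (\<lambda>n. (2 / sqrt (1 + (real n)\<^sup>2)) ^ m * (1 + (b * n / 4)\<^sup>2)) at_top sequentially"
  proof -
    have "filterlim (\<lambda>n. (2 / sqrt (1 + (real n)\<^sup>2)) ^ 0 * (1 + (b * n / 4)\<^sup>2)) at_top sequentially"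
      "filterlim (\<lambda>n. (2 / sqrt (1 + (real n)\<^sup>2)) ^ 1 * (1 + (b * n / 4)\<^sup>2)) at_top sequentially"
      using assms(1) by real_asymp+
    moreover have "m = 0 \<or> m = 1" using assms(2) by auto
    ultimately show ?thesis by blast
  qed
  ultimately have "\<forall>\<^sub>F n in sequentially. K < dist (polar_curve n) south_pole ^ m * (1 + (b * n / 4)\<^sup>2)"
    by (simp add: filterlim_at_top_dense)
  with bounded have "\<forall>\<^sub>F n :: nat in sequentially. False"
    by eventually_elim simp
  then show False by simp
qed

lemma has_pole_of_order_2:
  assumes "0 < b"
  shows "has_pole_of_order punctured_S3 south_pole (conformal_class punctured_S3 (unimodular_metric b)) 2"
  unfolding has_pole_of_order_def
proof (intro bexI conjI)
  show "unimodular_metric b \<in> conformal_class punctured_S3 (unimodular_metric b)"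
    by (auto simp: conformal_class_def intro!: exI[of _ "\<lambda>_. 1"])
  show "round_volume_on punctured_S3 (unimodular_metric b)"
    unfolding round_volume_on_def using det_unimodular by blast
qed (use assms growth_at_most_2 not_growth_at_most_less_2 in auto)

section \<open>The standard conformal structure for parameter zero\<close>

lemma conformal_class_unimodular_0:
  "conformal_class punctured_S3 (unimodular_metric 0) = conformal_class punctured_S3 round_metric"
  by (rule conformal_class_eqI[where c = "\<lambda>_. 1"]) (auto simp: unimodular_metric_0 round_metric_def)

text \<open>The value of the conformal factor at the south pole has to be the limit of its values along the curve.
  This limit exists because the second coordinate vector is tangent and of unit length along the whole
  curve, and is positive because it is the squared length of that vector at the south pole. Other
  tangent vectors at the south pole are limits of their tangential projections along the curve.\<close>

lemma metric_extensions_round: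
  "metric_extensions (conformal_class punctured_S3 round_metric)
    = {G \<in> conformal_class S3 round_metric. continuous_metric_on S3 G}"
proof (intro equalityI subsetI)
  fix G assume "G \<in> metric_extensions (conformal_class punctured_S3 round_metric)"
  then have G: "continuous_metric_on S3 G" and mem: "G \<in> conformal_class punctured_S3 round_metric"
    by (auto simp: metric_extensions_def)
  from mem obtain f where pos: "\<forall>p\<in>punctured_S3. 0 < f p"
    and f: "\<forall>p\<in>punctured_S3. \<forall>u\<in>sphere_tangent p. \<forall>v\<in>sphere_tangent p. G p u v = f p * (u \<bullet> v)"
    by (auto simp: conformal_class_def round_metric_def)
  define c where "c = G south_pole (axis 2 1) (axis 2 1)"
  have "(\<lambda>n. G (polar_curve n) (axis 2 1) (axis 2 1)) \<longlonglongrightarrow> c"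
    unfolding c_def
    by (intro continuous_metric_tendsto G polar_curve_S3 south_pole_S3 polar_curve_tendsto
        polar_curve_tangents south_pole_tangents tendsto_const)
  then have lim_f: "(\<lambda>n. f (polar_curve n)) \<longlonglongrightarrow> c"
    by (simp add: f polar_curve_mem polar_curve_tangents inner_axis_axis)
  have limit: "G south_pole u v = c * (u \<bullet> v)"
    if u: "u \<in> sphere_tangent south_pole" and v: "v \<in> sphere_tangent south_pole" for u v
  proof -
    define proj where "proj t n = t - (t \<bullet> polar_curve n) *\<^sub>R polar_curve n" for t n
    have proj: "proj t n \<in> sphere_tangent (polar_curve n)" for t n
      using punctured_S3D(2)[OF polar_curve_mem, of n]
      by (simp add: proj_def sphere_tangent_def inner_diff_left)
    have lim_proj: "proj t \<longlonglongrightarrow> t" if "t \<in> sphere_tangent south_pole" for t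
      unfolding proj_def
      by (rule tendsto_eq_intros polar_curve_tendsto refl | use sphere_tangentD[OF that] in simp)+
    have "(\<lambda>n. G (polar_curve n) (proj u n) (proj v n)) \<longlonglongrightarrow> G south_pole u v"
      by (intro continuous_metric_tendsto G polar_curve_S3 south_pole_S3 polar_curve_tendsto
          proj lim_proj u v)
    moreover have "(\<lambda>n. f (polar_curve n) * (proj u n \<bullet> proj v n)) \<longlonglongrightarrow> c * (u \<bullet> v)"
      by (intro tendsto_intros lim_f lim_proj u v)
    ultimately show ?thesis
      by (simp add: f polar_curve_mem proj LIMSEQ_unique)
  qed
  have "G \<in> conformal_class S3 round_metric"
    unfolding conformal_class_def round_metric_def
    using pos f limit continuous_metric_south_pole_pos[OF G]
    by (intro CollectI exI[of _ "f(south_pole := c)"]) (auto simp: c_def punctured_S3_def)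
  with G show "G \<in> {G \<in> conformal_class S3 round_metric. continuous_metric_on S3 G}" by simp
next
  fix G assume "G \<in> {G \<in> conformal_class S3 round_metric. continuous_metric_on S3 G}"
  then show "G \<in> metric_extensions (conformal_class punctured_S3 round_metric)"
    unfolding metric_extensions_def conformal_class_def punctured_S3_def by blast
qed

theorem proposition2:
  shows "(\<forall>b>0.
            metric_extensions (conformal_class punctured_S3 (boundary_metric b)) = {} \<and>
            has_pole_of_order punctured_S3 south_pole
              (conformal_class punctured_S3 (boundary_metric b)) 2 \<and>
            conformal_class punctured_S3 (boundary_metric b)
              = conformal_class punctured_S3 (boundary_model b)) \<and>
         conformal_class punctured_S3 (boundary_metric 0)
           = conformal_class punctured_S3 round_metric \<and>
         metric_extensions (conformal_class punctured_S3 (boundary_metric 0))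
           = {G \<in> conformal_class S3 round_metric. continuous_metric_on S3 G}"
  using no_metric_extension has_pole_of_order_2 metric_extensions_round
  by (simp add: boundary_class_eq_unimodular model_class_eq_unimodular conformal_class_unimodular_0)

end
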